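(* Let $p,q$ be two primes such that $p\neq 2$ and $q\mid p-1$, and let $n\ge 2$ be an integer. Then the finite nonabelian $P$-group $G$ of order $p^{n-1}q$ belongs to the class $\mathcal{C}_3$ if and only if either $n=2$, or $n=3$ and $p^2q\ge 1+p+2p^2$.
   Context: For a finite group $G$, $N(G)$ denotes the set of all normal subgroups of $G$ (including the trivial subgroup and $G$ itself). The class $\mathcal{C}_3$ consists of all finite groups $G$ with $\sum_{H\in N(G)}|H|\le 2|G|$. For primes $p\ne 2$ and $q\mid p-1$ and an integer $n\ge 2$, the nonabelian $P$-group of order $p^{n-1}q$ is the (unique up to isomorphism) semidirect product of an elementary abelian normal subgroup $A$ of order $p^{n-1}$ by a group of prime order $q$ which induces a nontrivial power automorphism on $A$ (a power automorphism of $A$ is an automorphism mapping every subgroup of $A$ onto itself; on an elementary abelian group $A$ of exponent $p$ it has the form $a\mapsto a^{r}$ for a fixed integer $r$ coprime to $p$). *)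

theory Defs
  imports "HOL-Algebra.Coset" "HOL-Computational_Algebra.Primes"
begin

definition normal_subgroups :: "('a, 'b) monoid_scheme \<Rightarrow> 'a set set"
  where "normal_subgroups G = {H. H \<lhd> G}"

definition class_C3 :: "('a, 'b) monoid_scheme \<Rightarrow> bool"
  where "class_C3 G \<longleftrightarrow>
    group G \<and> finite (carrier G) \<and> (\<Sum>H\<in>normal_subgroups G. card H) \<le> 2 * order G"

definition elementary_abelian :: "nat \<Rightarrow> ('a, 'b) monoid_scheme \<Rightarrow> bool"
  where "elementary_abelian p A \<longleftrightarrow>
    comm_group A \<and> (\<forall>a\<in>carrier A. a [^]\<^bsub>A\<^esub> p = \<one>\<^bsub>A\<^esub>)"

definition power_automorphism :: "('a, 'b) monoid_scheme \<Rightarrow> ('a \<Rightarrow> 'a) \<Rightarrow> bool"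
  where "power_automorphism A f \<longleftrightarrow>
    f \<in> iso A A \<and> (\<forall>H. subgroup H A \<longrightarrow> f ` H = H)"

definition internal_semidirect ::
    "('a, 'b) monoid_scheme \<Rightarrow> 'a set \<Rightarrow> 'a set \<Rightarrow> bool"
  where "internal_semidirect G A Q \<longleftrightarrow>
    A \<lhd> G \<and> subgroup Q G \<and> A \<inter> Q = {\<one>\<^bsub>G\<^esub>} \<and> A <#>\<^bsub>G\<^esub> Q = carrier G"

(* Every element of Q acts on A by a power automorphism, and not all of them act
   trivially; since Q has prime order, its generators are then exactly the
   elements acting nontrivially.  The action is the conjugation by b. *)
definition nonabelian_P_group ::
    "nat \<Rightarrow> nat \<Rightarrow> nat \<Rightarrow> ('a, 'b) monoid_scheme \<Rightarrow> bool"
  where "nonabelian_P_group p q n G \<longleftrightarrow>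
    group G \<and>
    (\<exists>A Q. internal_semidirect G A Q \<and>
       elementary_abelian p (G\<lparr>carrier := A\<rparr>) \<and> card A = p ^ (n - 1) \<and> card Q = q \<and>
       (\<forall>b\<in>Q. power_automorphism (G\<lparr>carrier := A\<rparr>)
                 (\<lambda>a. b \<otimes>\<^bsub>G\<^esub> a \<otimes>\<^bsub>G\<^esub> inv\<^bsub>G\<^esub> b)) \<and>
       (\<exists>b\<in>Q. \<exists>a\<in>A. b \<otimes>\<^bsub>G\<^esub> a \<otimes>\<^bsub>G\<^esub> inv\<^bsub>G\<^esub> b \<noteq> a))"

end

theory Submission
  imports Defs "HOL-Algebra.Elementary_Groups" "HOL-Algebra.Multiplicative_Group"
begin

text \<open>
  Write \<open>G = A Q\<close> with \<open>A\<close> elementary abelian of order \<open>p ^ m\<close>, \<open>m = n - 1\<close>, and \<open>Q\<close> of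
  order \<open>q\<close>. The normal subgroups of \<open>G\<close> are exactly \<open>G\<close> and the subgroups of \<open>A\<close>
  (lemma \<open>normal_subgroups_eq\<close>). Every subgroup of \<open>A\<close> is normal because \<open>A\<close> is abelian and
  \<open>Q\<close> acts by power automorphisms. Conversely, a nontrivial \<open>b \<in> Q\<close> acts without nontrivial
  fixed points, so that the commutators of \<open>b\<close> with elements of \<open>A\<close> fill all of \<open>A\<close>; hence a
  normal subgroup that leaves \<open>A\<close> contains \<open>A\<close>, then \<open>Q\<close>, and is \<open>G\<close>. As \<open>G\<close> has order
  \<open>p ^ m * q\<close>, membership in the class means that the orders of the subgroups of \<open>A\<close> add up
  to at most \<open>p ^ m * q\<close>.

  The number of subgroups of index \<open>p\<close> in \<open>A\<close> is \<open>(p ^ m - 1) / (p - 1)\<close>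
  (lemma \<open>card_index_p_subgroups_above\<close>). For \<open>m = 1\<close> the sum is \<open>1 + p \<le> p * q\<close>. For \<open>m = 2\<close>
  the subgroups of index \<open>p\<close> are those of order \<open>p\<close>; there are \<open>p + 1\<close> of them and the sum is
  \<open>1 + p + 2 * p ^ 2\<close>. For \<open>m \<ge> 3\<close> there are more than \<open>p * q\<close> subgroups of index \<open>p\<close>,
  since \<open>q < p\<close>, and these alone contribute more than \<open>p ^ m * q\<close>.
\<close>

section \<open>Orders of subgroups and of their products\<close>

lemma (in group) card_set_mult_trivial_Int:
  assumes "subgroup A G" "subgroup B G" "A \<inter> B = {\<one>}"
  shows "card (A <#> B) = card A * card B"
proof -
  interpret group_disjoint_sum G A B
    using assms by (simp add: group_disjoint_sum_def is_group)
  have "inj_on (\<lambda>(x, y). x \<otimes> y) (A \<times> B)"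
    using cancel assms(3) by (fastforce simp: inj_on_def)
  moreover have "A <#> B = (\<lambda>(x, y). x \<otimes> y) ` (A \<times> B)"
    by (force simp: set_mult_def)
  ultimately show ?thesis
    by (simp add: card_image card_cartesian_product)
qed

lemma (in group) finite_subgroups:
  assumes "finite (carrier G)"
  shows "finite {H. subgroup H G}"
  by (rule finite_subset[of _ "Pow (carrier G)"]) (use assms in \<open>auto dest: subgroup.subset\<close>)

lemma (in group) card_subgroup_dvd_card_subgroup:
  assumes "subgroup S G" "subgroup Q G" "S \<subseteq> Q"
  shows "card S dvd card Q"
proof -
  interpret Q: group "G\<lparr>carrier := Q\<rparr>"
    using assms(2) by (rule subgroup_imp_group)
  have "subgroup S (G\<lparr>carrier := Q\<rparr>)"
    by (rule subgroup_incl[OF assms])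
  from Q.lagrange[OF this] have "card (rcosets\<^bsub>G\<lparr>carrier := Q\<rparr>\<^esub> S) * card S = card Q"
    by (simp add: order_def)
  then show ?thesis
    by (metis dvd_triv_right)
qed

lemma (in group) subgroup_of_prime_order_eq:
  assumes "subgroup S G" "subgroup Q G" "S \<subseteq> Q" "prime (card Q)" "b \<in> S" "b \<noteq> \<one>"
  shows "S = Q"
proof -
  have fin: "finite Q"
    using prime_gt_0_nat[OF assms(4)] by (rule card_ge_0_finite)
  have "card S \<noteq> 1"
  proof
    assume "card S = 1"
    then obtain s where "S = {s}" by (rule card_1_singletonE)
    then show False using assms(5,6) subgroup.one_closed[OF assms(1)] by simp
  qed
  then have "card S = card Q"
    using card_subgroup_dvd_card_subgroup[OF assms(1-3)] assms(4) by (auto simp: prime_nat_iff)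
  then show ?thesis
    using card_subset_eq fin assms(3) by blast
qed

section \<open>Elementary abelian groups\<close>

locale elementary_abelian_group = comm_group +
  fixes p :: nat
  assumes prime_p: "prime p"
    and exponent: "x \<in> carrier G \<Longrightarrow> x [^] p = \<one>"
begin

lemma int_pow_dvd_eq_one:
  assumes "x \<in> carrier G" "int p dvd k"
  shows "x [^] k = \<one>"
proof -
  obtain l where "k = int p * l" using assms(2) by blast
  then show ?thesis
    using assms(1) exponent by (metis int_pow_int int_pow_one int_pow_pow)
qed

text \<open>
  An exponent that is prime to \<open>p\<close> is invertible modulo \<open>p\<close>, so the power can be undone
  inside the subgroup.
\<close>
lemma mem_subgroup_if_int_pow_mem:
  assumes H: "subgroup H G" and x: "x \<in> carrier G"
    and mem: "x [^] k \<in> H" and k: "\<not> int p dvd k"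
  shows "x \<in> H"
proof -
  have "coprime (int p) k"
    using k prime_p by (simp add: prime_imp_coprime)
  then obtain u v where uv: "u * int p + v * k = 1"
    using bezout_int[of "int p" k] by auto
  have "x = x [^] (u * int p + v * k)"
    using x uv by (simp add: int_pow_1)
  also have "\<dots> = x [^] (u * int p) \<otimes> x [^] (k * v)"
    using x by (simp add: int_pow_mult mult.commute)
  also have "\<dots> = (x [^] k) [^] v"
    using x by (simp add: int_pow_dvd_eq_one int_pow_pow)
  finally show ?thesis
    using mem H by (metis subgroup_int_pow_closed)
qed

lemma card_generate:
  assumes "x \<in> carrier G" "x \<noteq> \<one>"
  shows "card (generate G {x}) = p"
proof -
  have "ord x dvd p" using exponent[OF assms(1)] pow_eq_id[OF assms(1)] by blast
  moreover have "ord x \<noteq> 1" using assms(2) ord_eq_1[OF assms(1)] by blast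
  ultimately show ?thesis
    using prime_p generate_pow_card[OF assms(1)] by (auto simp: prime_nat_iff)
qed

lemma generate_Int_trivial:
  assumes N: "subgroup N G" and x: "x \<in> carrier G" "x \<notin> N"
  shows "N \<inter> generate G {x} = {\<one>}"
proof -
  have "y = \<one>" if y: "y \<in> N" "y \<in> generate G {x}" for y
  proof -
    obtain k :: int where k: "y = x [^] k" using generate_pow[OF x(1)] y(2) by auto
    then have "int p dvd k"
      using mem_subgroup_if_int_pow_mem[OF N x(1)] y(1) x(2) by blast
    then show ?thesis using k x int_pow_dvd_eq_one by simp
  qed
  moreover have "\<one> \<in> N \<inter> generate G {x}"
    using N generate.one subgroup.one_closed by fastforce
  ultimately show ?thesis by blast
qed

text \<open>
  The index condition is stated as a product of orders, which avoids division. Fixing a lower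
  bound \<open>N\<close> makes an induction on the rank of \<open>G\<close> modulo \<open>N\<close> possible without forming
  quotient groups.
\<close>
definition index_p_subgroups_above :: "'a set \<Rightarrow> 'a set set" where
  "index_p_subgroups_above N = {H. subgroup H G \<and> N \<subseteq> H \<and> p * card H = order G}"

lemma index_p_subgroups_above_join:
  assumes N: "subgroup N G" and x: "x \<in> carrier G"
  shows "index_p_subgroups_above (N <#> generate G {x}) = {H \<in> index_p_subgroups_above N. x \<in> H}"
proof -
  have gen: "subgroup (generate G {x}) G"
    using x by (simp add: generate_is_subgroup)
  have sub: "N <#> generate G {x} \<subseteq> H \<longleftrightarrow> N \<subseteq> H \<and> x \<in> H" if H: "subgroup H G" for H
  proof
    assume *: "N <#> generate G {x} \<subseteq> H"
    have "y \<in> N <#> generate G {x}" if "y \<in> N" for y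
      using that subgroup.mem_carrier[OF N] generate.one[of G "{x}"]
      by (force simp: set_mult_def)
    moreover have "\<one> \<otimes> x \<in> N <#> generate G {x}"
      using subgroup.one_closed[OF N] generate.incl[of x "{x}" G] unfolding set_mult_def by blast
    ultimately show "N \<subseteq> H \<and> x \<in> H" using * x by auto
  next
    assume *: "N \<subseteq> H \<and> x \<in> H"
    then have "generate G {x} \<subseteq> H" using H by (simp add: generate_subgroup_incl)
    with * show "N <#> generate G {x} \<subseteq> H"
      using subgroup.m_closed[OF H] by (auto simp: set_mult_def)
  qed
  then show ?thesis unfolding index_p_subgroups_above_def by blast
qed

text \<open>
  This is the number of hyperplanes in a vector space of dimension \<open>k\<close> over the field with \<open>p\<close>
  elements. The induction step counts the pairs \<open>(x, H)\<close> with \<open>x \<in> H - N\<close> in two ways. For a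
  fixed \<open>x\<close> the candidates \<open>H\<close> are those above the join of \<open>N\<close> and \<open>x\<close>, whose rank below \<open>G\<close>
  is one less, so the induction hypothesis counts them; for a fixed \<open>H\<close> the number of \<open>x\<close> is
  \<open>card H - card N\<close>. The case \<open>k = 0\<close>, in which no such \<open>H\<close> exists, cannot start this
  induction because the cancelled factor \<open>p ^ k - 1\<close> would vanish.
\<close>
lemma card_index_p_subgroups_above:
  assumes fin: "finite (carrier G)" and "subgroup N G" and "card N * p ^ k = order G" and "k \<ge> 1"
  shows "card (index_p_subgroups_above N) * (p - 1) = p ^ k - 1"
  using assms(4,2,3)
proof (induction k arbitrary: N rule: dec_induct)
  case base
  have "H = N" if "H \<in> index_p_subgroups_above N" for H
  proof -
    have H: "subgroup H G" "N \<subseteq> H" "p * card H = card N * p"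
      using that base by (auto simp: index_p_subgroups_above_def)
    then have "card H = card N"
      using prime_gt_0_nat[OF prime_p] by simp
    then show ?thesis
      using H fin by (metis card_subset_eq finite_subset subgroup.subset)
  qed
  moreover have "N \<in> index_p_subgroups_above N"
    using base by (auto simp: index_p_subgroups_above_def mult.commute)
  ultimately have "index_p_subgroups_above N = {N}" by blast
  then show ?case by simp
next
  case (step k)
  let ?M = "index_p_subgroups_above N"
  let ?c = "card N"
  have p1: "p > 1" using prime_p prime_gt_1_nat by simp
  have finM: "finite ?M"
    by (rule finite_subset[OF _ finite_subgroups[OF fin]]) (auto simp: index_p_subgroups_above_def)
  have Nsub: "N \<subseteq> carrier G" using step.prems(1) by (rule subgroup.subset)
  have finN: "finite N" using Nsub fin finite_subset by blast
  have c0: "?c > 0"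
    using subgroup.one_closed[OF step.prems(1)] finN card_gt_0_iff by blast
  have in_M: "(p - 1) * card {H \<in> ?M. x \<in> H} = p ^ k - 1" if x: "x \<in> carrier G - N" for x
  proof -
    have x': "x \<in> carrier G" "x \<notin> N" "x \<noteq> \<one>"
      using x subgroup.one_closed[OF step.prems(1)] by auto
    let ?J = "N <#> generate G {x}"
    have gen: "subgroup (generate G {x}) G" using x' by (simp add: generate_is_subgroup)
    have J: "subgroup ?J G" using mult_subgroups step.prems(1) gen by blast
    have "card ?J = ?c * p"
      using card_set_mult_trivial_Int[OF step.prems(1) gen generate_Int_trivial] card_generate
        step.prems(1) x' by simp
    then have "card ?J * p ^ k = order G" using step.prems(2) by simp
    from step.IH[OF J this] show ?thesis
      using index_p_subgroups_above_join[OF step.prems(1) x'(1)] by (simp add: mult.commute)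
  qed
  have in_H: "card {x \<in> carrier G - N. x \<in> H} = ?c * (p ^ k - 1)" if H: "H \<in> ?M" for H
  proof -
    have H': "subgroup H G" "N \<subseteq> H" "p * card H = ?c * p ^ Suc k"
      using H step.prems(2) by (auto simp: index_p_subgroups_above_def)
    have "{x \<in> carrier G - N. x \<in> H} = H - N"
      using subgroup.subset[OF H'(1)] by blast
    moreover have "card H = ?c * p ^ k" using H'(3) p1 by simp
    ultimately show ?thesis
      using finN H'(2) by (simp add: card_Diff_subset diff_mult_distrib2)
  qed
  have "(\<Sum>x\<in>carrier G - N. card {H \<in> ?M. x \<in> H}) = (\<Sum>H\<in>?M. ?c * (p ^ k - 1))"
    by (rule sum_multicount_gen) (use fin finM in_H in auto)
  then have "(\<Sum>x\<in>carrier G - N. (p - 1) * card {H \<in> ?M. x \<in> H})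
      = (p - 1) * (card ?M * (?c * (p ^ k - 1)))"
    by (simp flip: sum_distrib_left)
  moreover have "(\<Sum>x\<in>carrier G - N. (p - 1) * card {H \<in> ?M. x \<in> H})
      = card (carrier G - N) * (p ^ k - 1)"
    using in_M by simp
  moreover have "card (carrier G - N) = ?c * (p ^ Suc k - 1)"
    using Nsub finN step.prems(2) by (simp add: card_Diff_subset order_def diff_mult_distrib2)
  ultimately have "(card ?M * (p - 1)) * (?c * (p ^ k - 1)) = (p ^ Suc k - 1) * (?c * (p ^ k - 1))"
    by (simp add: ac_simps)
  moreover have "p ^ k > 1" using one_less_power[OF p1] step.hyps by simp
  ultimately show ?case using c0 by simp
qed

section \<open>Power automorphisms\<close>

lemma fixed_points_subgroup:
  assumes "f \<in> hom G G"
  shows "subgroup {a \<in> carrier G. f a = a} G"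
proof -
  interpret f: group_hom G G f
    using assms by (simp add: group_hom_def group_hom_axioms_def is_group)
  show ?thesis by (rule subgroupI) (auto intro: exI[of _ \<one>])
qed

lemma power_automorphism_obtains_exponent:
  assumes f: "power_automorphism G f" and x: "x \<in> carrier G"
  obtains k :: int where "f x = x [^] k"
proof -
  have "f ` generate G {x} = generate G {x}"
    using f x by (simp add: power_automorphism_def generate_is_subgroup)
  then have "f x \<in> generate G {x}" using generate.incl[of x "{x}" G] by blast
  then show ?thesis using that generate_pow[OF x] by auto
qed

lemma comm_cross_cancel:
  assumes "a \<otimes> b = d \<otimes> e"
    and "a \<in> carrier G" "b \<in> carrier G" "d \<in> carrier G" "e \<in> carrier G"
  shows "b \<otimes> inv e = d \<otimes> inv a"
proof -
  have "b \<otimes> inv e = inv a \<otimes> (a \<otimes> b) \<otimes> inv e"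
    using assms(2-5) by (simp flip: m_assoc)
  also have "\<dots> = inv a \<otimes> (d \<otimes> e) \<otimes> inv e"
    using assms(1) by simp
  also have "\<dots> = d \<otimes> inv a"
    using assms(2-5) by (simp add: m_assoc) (simp add: m_comm)
  finally show ?thesis .
qed

text \<open>
  Let \<open>f x = x ^ k\<close>, and let \<open>c\<close> be a nontrivial fixed point. As \<open>f\<close> also maps \<open>x c\<close> to a
  power \<open>(x c) ^ j\<close>, comparison with \<open>f x f c\<close> gives \<open>c ^ (j - 1) = x ^ (k - j)\<close>. This element
  is fixed by \<open>f\<close>; since \<open>x\<close> is not, \<open>p\<close> divides \<open>k - j\<close>. Then \<open>c ^ (j - 1)\<close> is trivial, so
  \<open>p\<close> divides \<open>j - 1\<close> as well, hence \<open>k - 1\<close>, and \<open>x\<close> would be fixed after all.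
\<close>
lemma power_automorphism_fixed_point_free:
  assumes f: "power_automorphism G f" and x: "x \<in> carrier G" "f x \<noteq> x"
    and c: "c \<in> carrier G" "f c = c"
  shows "c = \<one>"
proof (rule ccontr)
  assume c1: "c \<noteq> \<one>"
  have hom: "f \<in> hom G G" using f by (simp add: power_automorphism_def iso_def)
  let ?F = "{a \<in> carrier G. f a = a}"
  have F: "subgroup ?F G" by (rule fixed_points_subgroup[OF hom])
  obtain k :: int where k: "f x = x [^] k"
    using power_automorphism_obtains_exponent[OF f x(1)] .
  obtain j :: int where j: "f (x \<otimes> c) = (x \<otimes> c) [^] j"
    using power_automorphism_obtains_exponent[OF f, of "x \<otimes> c"] x c by auto
  have "x [^] j \<otimes> c [^] j = x [^] k \<otimes> c"
    using j k hom x c by (simp add: hom_mult int_pow_distrib)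
  then have eq: "c [^] (j - 1) = x [^] (k - j)"
    using x(1) c(1) comm_cross_cancel[of "x [^] j" "c [^] j" "x [^] k" c]
    by (simp add: int_pow_diff int_pow_1)
  have "c [^] (j - 1) \<in> ?F"
    using subgroup_int_pow_closed[OF F] c by blast
  then have kj: "int p dvd k - j"
    using mem_subgroup_if_int_pow_mem[OF F x(1)] x(2) eq by auto
  then have "c [^] (j - 1) = \<one>"
    using eq x int_pow_dvd_eq_one by simp
  then have "int p dvd j - 1"
    using mem_subgroup_if_int_pow_mem[OF triv_subgroup c(1)] c1 by auto
  with kj have "int p dvd k - 1" using dvd_add by fastforce
  then have "x [^] (k - 1) = \<one>" using x int_pow_dvd_eq_one by simp
  then have "x [^] k = x"
    using x(1) int_pow_mult[of x "k - 1" 1] by (simp add: int_pow_1)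
  then show False using k x by simp
qed

text \<open>
  The map is an endomorphism whose kernel consists of the fixed points of \<open>f\<close>; it is thus
  injective, and on a finite group surjective. For \<open>f\<close> the conjugation by \<open>b\<close>, its values are
  the commutators of \<open>b\<close> with the elements of the group.
\<close>
lemma power_automorphism_displacement_surj:
  assumes fin: "finite (carrier G)"
    and f: "power_automorphism G f" and x: "x \<in> carrier G" "f x \<noteq> x"
  shows "(\<lambda>a. f a \<otimes> inv a) ` carrier G = carrier G"
proof -
  have hom: "f \<in> hom G G" using f by (simp add: power_automorphism_def iso_def)
  interpret f: group_hom G G f
    using hom by (simp add: group_hom_def group_hom_axioms_def is_group)
  interpret d: group_hom G G "\<lambda>a. f a \<otimes> inv a"
    by unfold_locales (auto simp: hom_def inv_mult m_ac)
  have "inj_on (\<lambda>a. f a \<otimes> inv a) (carrier G)"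
  proof -
    have "a = \<one>" if a: "a \<in> carrier G" "f a \<otimes> inv a = \<one>" for a
      using power_automorphism_fixed_point_free[OF f x] a
inv_equality[of "f a" "inv a"] by simp
    then show ?thesis using d.inj_on_one_iff by blast
  qed
  moreover have "(\<lambda>a. f a \<otimes> inv a) ` carrier G \<subseteq> carrier G" by auto
  ultimately show ?thesis using fin by (simp add: endo_inj_surj)
qed

section \<open>Sums of subgroup orders\<close>

lemma obtains_card_subgroup_power:
  assumes "order G = p ^ m" and "subgroup H G"
  obtains i where "i \<le> m" "card H = p ^ i"
proof -
  have "card H dvd p ^ m"
    using lagrange[OF assms(2)] assms(1) by (metis dvd_triv_right)
  then show ?thesis
    using that prime_p by (auto simp: divides_primepow_nat)
qed

lemma subgroup_eq_trivial_if_card: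
  assumes "subgroup H G" "card H = 1"
  shows "H = {\<one>}"
  using assms subgroup.one_closed by (metis card_1_singletonE singletonD)

lemma subgroup_eq_carrier_if_card:
  assumes "finite (carrier G)" "subgroup H G" "card H = order G"
  shows "H = carrier G"
  using assms by (simp add: card_subset_eq order_def subgroup.subset)

lemma sum_card_subgroups_rank_1:
  assumes ord: "order G = p"
  shows "(\<Sum>H | subgroup H G. card H) = 1 + p"
proof -
  have p1: "p > 1" using prime_p prime_gt_1_nat by simp
  have fin: "finite (carrier G)" using ord p1 by (simp add: order_def card_ge_0_finite)
  have "H = {\<one>} \<or> H = carrier G" if H: "subgroup H G" for H
  proof -
    obtain i where i: "i \<le> 1" "card H = p ^ i"
      using obtains_card_subgroup_power[of 1 H] ord H by auto
    then have "card H = 1 \<or> card H = order G" using ord by (auto simp: le_Suc_eq)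
    then show ?thesis
      using H fin subgroup_eq_trivial_if_card subgroup_eq_carrier_if_card by blast
  qed
  then have "{H. subgroup H G} = {{\<one>}, carrier G}"
    using triv_subgroup subgroup_self by blast
  moreover have "carrier G \<noteq> {\<one>}" using ord p1 by (auto simp: order_def)
  ultimately show ?thesis using ord by (simp add: order_def)
qed

lemma sum_card_subgroups_rank_2:
  assumes ord: "order G = p ^ 2"
  shows "(\<Sum>H | subgroup H G. card H) = 1 + p + 2 * p ^ 2"
proof -
  have p1: "p > 1" using prime_p prime_gt_1_nat by simp
  have fin: "finite (carrier G)" using ord p1 by (simp add: order_def card_ge_0_finite)
  let ?M = "index_p_subgroups_above {\<one>}"
  have M_iff: "H \<in> ?M \<longleftrightarrow> subgroup H G \<and> card H = p" for H
    using ord p1 subgroup.one_closed[of H G]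
    by (auto simp: index_p_subgroups_above_def power2_eq_square)
  have finM: "finite ?M"
    by (rule finite_subset[OF _ finite_subgroups[OF fin]]) (auto simp: index_p_subgroups_above_def)
  have "card ?M * (p - 1) = p ^ 2 - 1"
    using card_index_p_subgroups_above[OF fin triv_subgroup, of 2] ord by simp
  also have "\<dots> = (p + 1) * (p - 1)"
    by (simp add: power2_eq_square diff_mult_distrib2)
  finally have cardM: "card ?M = p + 1"
    using p1 by (subst (asm) mult_cancel2) simp
  have "H \<in> {{\<one>}, carrier G} \<union> ?M" if H: "subgroup H G" for H
  proof -
    obtain i where i: "i \<le> 2" "card H = p ^ i"
      using obtains_card_subgroup_power[of 2 H] ord H by auto
    then have "card H = 1 \<or> card H = p \<or> card H = order G"
      using ord by (auto simp: le_Suc_eq numeral_2_eq_2)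
    then show ?thesis
      using H fin subgroup_eq_trivial_if_card subgroup_eq_carrier_if_card M_iff by blast
  qed
  then have "{H. subgroup H G} = {{\<one>}, carrier G} \<union> ?M"
    using triv_subgroup subgroup_self M_iff by blast
  moreover have "card (carrier G) = p ^ 2" using ord by (simp add: order_def)
  moreover have "carrier G \<noteq> {\<one>}" "{\<one>} \<notin> ?M" "carrier G \<notin> ?M"
    using calculation(2) p1 by (auto simp: M_iff power2_eq_square)
  moreover have "(\<Sum>H\<in>?M. card H) = (p + 1) * p"
    using cardM by (simp add: M_iff)
  ultimately show ?thesis using finM
    by (simp add: power2_eq_square)
qed

text \<open>
  The subgroups of index \<open>p\<close> suffice: each has order \<open>p ^ (m - 1)\<close>, and there are at least
  \<open>1 + p + p ^ 2 > p * q\<close> of them.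
\<close>
lemma sum_card_subgroups_rank_ge_3:
  assumes ord: "order G = p ^ m" and m: "m \<ge> 3" and q: "q < p"
  shows "p ^ m * q < (\<Sum>H | subgroup H G. card H)"
proof -
  have p1: "p > 1" using prime_p prime_gt_1_nat by simp
  have fin: "finite (carrier G)" using ord p1 by (simp add: order_def card_ge_0_finite)
  let ?M = "index_p_subgroups_above {\<one>}"
  have m': "p ^ m = p * p ^ (m - 1)" using m by (simp flip: power_Suc)
  have card_mem: "card H = p ^ (m - 1)" if "H \<in> ?M" for H
  proof -
    have "p * card H = p * p ^ (m - 1)"
      using that ord m' by (simp add: index_p_subgroups_above_def)
    then show ?thesis using p1 by simp
  qed
  have "p * q * (p - 1) \<le> p * (p - 1) * (p - 1)"
    using q by (intro mult_right_mono mult_left_mono) auto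
  also have "\<dots> < p ^ 3 - 1"
    \<comment> \<open>Writing \<open>p = r + 2\<close> removes the truncated subtractions.\<close>
  proof -
    obtain r where "p = r + 2" using p1 by (metis add.commute less_iff_succ_less_eq le_Suc_ex nat_1_add_1)
    then show ?thesis by (simp add: algebra_simps power3_eq_cube)
  qed
  also have "\<dots> \<le> p ^ m - 1"
    using m p1 by (intro diff_le_mono power_increasing) auto
  also have "\<dots> = card ?M * (p - 1)"
    using card_index_p_subgroups_above[OF fin triv_subgroup, of m] ord m by simp
  finally have "p * q < card ?M" by simp
  then have "p ^ (m - 1) * (p * q) < p ^ (m - 1) * card ?M" using p1 by simp
  also have "\<dots> = (\<Sum>H\<in>?M. card H)" by (simp add: card_mem)
  also have "\<dots> \<le> (\<Sum>H | subgroup H G. card H)"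
    by (rule sum_mono2[OF finite_subgroups[OF fin]]) (auto simp: index_p_subgroups_above_def)
  finally show ?thesis by (simp add: m' ac_simps)
qed

end

section \<open>Normal subgroups of a nonabelian P-group\<close>

text \<open>
  A fixed choice of the kernel \<open>A\<close> and the complement \<open>Q\<close> of a nonabelian P-group.
\<close>
locale P_group_decomposition = group +
  fixes A Q :: "'a set" and p :: nat
  assumes normal_A: "A \<lhd> G" and subgroup_Q: "subgroup Q G"
    and A_Int_Q: "A \<inter> Q = {\<one>}" and A_mult_Q: "A <#> Q = carrier G"
    and elementary_abelian_A: "elementary_abelian_group (G\<lparr>carrier := A\<rparr>) p"
    and finite_A: "finite A" and prime_card_Q: "prime (card Q)"
    and conj_power_automorphism:
      "b \<in> Q \<Longrightarrow> power_automorphism (G\<lparr>carrier := A\<rparr>) (\<lambda>a. b \<otimes> a \<otimes> inv b)"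
    and nontrivial_action: "\<exists>b\<in>Q. \<exists>a\<in>A. b \<otimes> a \<otimes> inv b \<noteq> a"
begin

lemma subgroup_A: "subgroup A G"
  using normal_A by (rule normal_imp_subgroup)

lemma mem_carrier:
  assumes "x \<in> A \<or> x \<in> Q"
  shows "x \<in> carrier G"
  using assms subgroup.mem_carrier[OF subgroup_A] subgroup.mem_carrier[OF subgroup_Q] by auto

lemma A_commute:
  assumes "a \<in> A" "c \<in> A"
  shows "a \<otimes> c = c \<otimes> a"
proof -
  interpret A: elementary_abelian_group "G\<lparr>carrier := A\<rparr>" p by (rule elementary_abelian_A)
  show ?thesis using A.m_comm[of a c] assms by simp
qed

text \<open>
  Conjugation by \<open>a b\<close> with \<open>a \<in> A\<close> and \<open>b \<in> Q\<close> maps \<open>H\<close> into \<open>H\<close>: the action of \<open>b\<close>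
  preserves every subgroup of \<open>A\<close>, and \<open>a\<close> centralizes \<open>A\<close>.
\<close>
lemma subgroup_of_A_normal:
  assumes H: "subgroup H G" "H \<subseteq> A"
  shows "H \<lhd> G"
proof (rule normal_invI[OF H(1)])
  fix x h assume x: "x \<in> carrier G" and h: "h \<in> H"
  obtain a b where ab: "a \<in> A" "b \<in> Q" "x = a \<otimes> b"
    using x A_mult_Q unfolding set_mult_def by blast
  have carr: "a \<in> carrier G" "b \<in> carrier G" "h \<in> carrier G"
    using mem_carrier[of a] mem_carrier[of b] ab(1,2) subgroup.mem_carrier[OF H(1) h] by simp_all
  have "subgroup H (G\<lparr>carrier := A\<rparr>)" using subgroup_incl[OF H(1) subgroup_A H(2)] .
  then have "(\<lambda>a. b \<otimes> a \<otimes> inv b) ` H = H"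
    using conj_power_automorphism[OF ab(2)] by (simp add: power_automorphism_def)
  then have k: "b \<otimes> h \<otimes> inv b \<in> H" using imageI[OF h, of "\<lambda>a. b \<otimes> a \<otimes> inv b"] by simp
  let ?k = "b \<otimes> h \<otimes> inv b"
  have "x \<otimes> h \<otimes> inv x = a \<otimes> ?k \<otimes> inv a"
    using carr ab(3) by (simp add: m_assoc inv_mult_group)
  also have "a \<otimes> ?k = ?k \<otimes> a"
    by (rule A_commute[OF ab(1) subsetD[OF H(2) k]])
  also have "?k \<otimes> a \<otimes> inv a = ?k"
    using carr by (simp add: m_assoc)
  finally show "x \<otimes> h \<otimes> inv x \<in> H" using k by simp
qed

text \<open>
  The elements of \<open>Q\<close> that centralize \<open>A\<close> form a subgroup of \<open>Q\<close>. As \<open>Q\<close> has prime order, it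
  would be all of \<open>Q\<close> if it contained \<open>b\<close>.
\<close>
lemma nontrivial_element_acts_nontrivially:
  assumes b: "b \<in> Q" "b \<noteq> \<one>"
  shows "\<exists>a\<in>A. b \<otimes> a \<otimes> inv b \<noteq> a"
proof (rule ccontr)
  assume trivial: "\<not> ?thesis"
  let ?S = "{c \<in> Q. \<forall>a\<in>A. c \<otimes> a \<otimes> inv c = a}"
  have "subgroup ?S G"
  proof (rule subgroupI)
    show "?S \<noteq> {}"
      using subgroup.one_closed[OF subgroup_Q] mem_carrier by (auto intro!: exI[of _ \<one>])
  next
    fix c assume c: "c \<in> ?S"
    have "inv c \<otimes> a \<otimes> inv (inv c) = a" if a: "a \<in> A" for a
    proof -
      have carr: "a \<in> carrier G" "c \<in> carrier G" using a c mem_carrier by auto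
      have "inv c \<otimes> a \<otimes> inv (inv c) = inv c \<otimes> (c \<otimes> a \<otimes> inv c) \<otimes> c"
        using a c carr by auto
      also have "\<dots> = a"
        using carr by (simp add: m_assoc) (simp flip: m_assoc)
      finally show ?thesis .
    qed
    then show "inv c \<in> ?S" using c subgroup.m_inv_closed[OF subgroup_Q] by auto
  next
    fix c d assume c: "c \<in> ?S" and d: "d \<in> ?S"
    have "(c \<otimes> d) \<otimes> a \<otimes> inv (c \<otimes> d) = a" if a: "a \<in> A" for a
    proof -
      have "(c \<otimes> d) \<otimes> a \<otimes> inv (c \<otimes> d) = c \<otimes> (d \<otimes> a \<otimes> inv d) \<otimes> inv c"
        using a c d mem_carrier by (simp add: m_assoc inv_mult_group)
      then show ?thesis using a c d by auto
    qed
    then show "c \<otimes> d \<in> ?S" using c d subgroup.m_closed[OF subgroup_Q] by auto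
  qed (use mem_carrier in blast)
  then have "?S = Q"
    by (rule subgroup_of_prime_order_eq) (use subgroup_Q prime_card_Q b trivial in auto)
  then show False using nontrivial_action by blast
qed

text \<open>
  An element \<open>h = c b\<close> of \<open>H\<close> outside \<open>A\<close> has a nontrivial component \<open>b \<in> Q\<close>. Its commutator
  with \<open>a \<in> A\<close> lies in the normal subgroup \<open>H\<close> and equals the commutator of \<open>b\<close> with \<open>a\<close>,
  because \<open>c\<close> centralizes \<open>A\<close>. These commutators fill \<open>A\<close>, so \<open>H\<close> contains \<open>A\<close>, therefore
  \<open>b\<close>, and therefore the group \<open>Q\<close> of prime order.
\<close>
lemma normal_subgroup_not_in_A:
  assumes H: "H \<lhd> G" and not_sub: "\<not> H \<subseteq> A"
  shows "H = carrier G"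
proof -
  have Hsub: "subgroup H G" using H by (rule normal_imp_subgroup)
  obtain h where h: "h \<in> H" "h \<notin> A" using not_sub by blast
  have "h \<in> A <#> Q" using subgroup.mem_carrier[OF Hsub h(1)] A_mult_Q by simp
  then obtain c b where cb: "c \<in> A" "b \<in> Q" "h = c \<otimes> b"
    unfolding set_mult_def by blast
  have carr: "c \<in> carrier G" "b \<in> carrier G"
    using mem_carrier[of c] mem_carrier[of b] cb(1,2) by simp_all
  have b1: "b \<noteq> \<one>"
  proof
    assume "b = \<one>"
    then have "h = c" using cb(3) carr by simp
    then show False using cb(1) h(2) by simp
  qed
  let ?A = "G\<lparr>carrier := A\<rparr>"
  let ?f = "\<lambda>a. b \<otimes> a \<otimes> inv b"
  obtain x where x: "x \<in> A" "?f x \<noteq> x"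
    using nontrivial_element_acts_nontrivially cb(2) b1 by blast
  have "(\<lambda>a. ?f a \<otimes>\<^bsub>?A\<^esub> inv\<^bsub>?A\<^esub> a) ` carrier ?A = carrier ?A"
    by (rule elementary_abelian_group.power_automorphism_displacement_surj
        [OF elementary_abelian_A _ conj_power_automorphism[OF cb(2)], of x])
       (use finite_A x in auto)
  then have surj: "(\<lambda>a. ?f a \<otimes> inv a) ` A = A"
    using m_inv_consistent[OF subgroup_A] by simp
  have "A \<subseteq> H"
  proof
    fix y assume "y \<in> A"
    then obtain a where a: "a \<in> A" "y = ?f a \<otimes> inv a" using surj by blast
    have acarr: "a \<in> carrier G" using mem_carrier[of a] a(1) by simp
    have fa: "?f a \<in> A"
      using normal.inv_op_closed2[OF normal_A carr(2) a(1)] .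
    have "h \<otimes> a \<otimes> inv h = c \<otimes> ?f a \<otimes> inv c"
      using cb(3) carr acarr by (simp add: m_assoc inv_mult_group)
    also have "\<dots> = ?f a"
      unfolding A_commute[OF cb(1) fa] using carr acarr by (simp add: m_assoc)
    finally have "y = h \<otimes> a \<otimes> inv h \<otimes> inv a" using a(2) by simp
    also have "\<dots> = h \<otimes> (a \<otimes> inv h \<otimes> inv a)"
      using acarr subgroup.mem_carrier[OF Hsub h(1)] by (simp add: m_assoc)
    finally have "y = h \<otimes> (a \<otimes> inv h \<otimes> inv a)" .
    moreover have "a \<otimes> inv h \<otimes> inv a \<in> H"
      using normal.inv_op_closed2[OF H acarr] subgroup.m_inv_closed[OF Hsub h(1)] by simp
    ultimately show "y \<in> H" using h(1) subgroup.m_closed[OF Hsub] by simp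
  qed
  have "b = inv c \<otimes> h" using cb(3) carr by (simp flip: m_assoc)
  then have "b \<in> H"
    using \<open>A \<subseteq> H\<close> cb(1) h(1) subgroup.m_closed[OF Hsub] subgroup.m_inv_closed[OF Hsub] by blast
  have "H \<inter> Q = Q"
    by (rule subgroup_of_prime_order_eq[OF subgroups_Inter_pair[OF Hsub subgroup_Q] subgroup_Q, of b])
       (use prime_card_Q cb(2) \<open>b \<in> H\<close> b1 in auto)
  then have "A <#> Q \<subseteq> H"
    using \<open>A \<subseteq> H\<close> subgroup.m_closed[OF Hsub] unfolding set_mult_def by blast
  then show ?thesis using A_mult_Q subgroup.subset[OF Hsub] by blast
qed

lemma normal_subgroups_eq:
  "normal_subgroups G = insert (carrier G) {H. subgroup H (G\<lparr>carrier := A\<rparr>)}"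
proof -
  have "carrier G \<lhd> G"
    by (rule normal_invI[OF subgroup_self]) simp_all
  moreover have "H \<lhd> G" if "subgroup H (G\<lparr>carrier := A\<rparr>)" for H
    using incl_subgroup[OF subgroup_A that] subgroup.subset[OF that] subgroup_of_A_normal by simp
  moreover have "H = carrier G \<or> subgroup H (G\<lparr>carrier := A\<rparr>)" if "H \<lhd> G" for H
    using normal_subgroup_not_in_A[OF that] subgroup_incl[OF normal_imp_subgroup[OF that] subgroup_A]
    by blast
  ultimately show ?thesis unfolding normal_subgroups_def by blast
qed

lemma order_eq_card_mult: "order G = card A * card Q"
  using card_set_mult_trivial_Int[OF subgroup_A subgroup_Q A_Int_Q] A_mult_Q
  by (simp add: order_def)

lemma sum_card_normal_subgroups:
  "(\<Sum>H\<in>normal_subgroups G. card H)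
    = order G + (\<Sum>H | subgroup H (G\<lparr>carrier := A\<rparr>). card H)"
proof -
  have "card A > 0"
    using finite_A subgroup.one_closed[OF subgroup_A] card_gt_0_iff by blast
  then have "card A < card (carrier G)"
    using order_eq_card_mult prime_gt_1_nat[OF prime_card_Q] by (simp add: order_def)
  then have "\<not> carrier G \<subseteq> A"
    using card_mono[OF finite_A, of "carrier G"] by auto
  then have "\<not> subgroup (carrier G) (G\<lparr>carrier := A\<rparr>)"
    using subgroup.subset[of "carrier G" "G\<lparr>carrier := A\<rparr>"] by auto
  moreover have "finite {H. subgroup H (G\<lparr>carrier := A\<rparr>)}"
    using group.finite_subgroups[OF subgroup_imp_group[OF subgroup_A]] finite_A by simp
  ultimately show ?thesis by (simp add: normal_subgroups_eq order_def)
qed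

end

lemma nonabelian_P_group_decomposition:
  assumes "prime p" "prime q" "nonabelian_P_group p q n G"
  obtains A Q where "P_group_decomposition G A Q p" "card A = p ^ (n - 1)" "card Q = q"
proof -
  obtain A Q where G: "group G" and semi: "internal_semidirect G A Q"
    and ea: "elementary_abelian p (G\<lparr>carrier := A\<rparr>)"
    and card: "card A = p ^ (n - 1)" "card Q = q"
    and act: "\<forall>b\<in>Q. power_automorphism (G\<lparr>carrier := A\<rparr>)
        (\<lambda>a. b \<otimes>\<^bsub>G\<^esub> a \<otimes>\<^bsub>G\<^esub> inv\<^bsub>G\<^esub> b)"
      "\<exists>b\<in>Q. \<exists>a\<in>A. b \<otimes>\<^bsub>G\<^esub> a \<otimes>\<^bsub>G\<^esub> inv\<^bsub>G\<^esub> b \<noteq> a"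
    using assms(3) unfolding nonabelian_P_group_def by blast
  have "elementary_abelian_group (G\<lparr>carrier := A\<rparr>) p"
    using ea assms(1)
    by (simp add: elementary_abelian_def elementary_abelian_group_def
        elementary_abelian_group_axioms_def)
  moreover have "finite A"
    using card(1) prime_gt_0_nat[OF assms(1)] by (simp add: card_ge_0_finite)
  ultimately have "P_group_decomposition G A Q p"
    using G semi act card(2) assms(2)
    by (simp add: P_group_decomposition_def P_group_decomposition_axioms_def internal_semidirect_def)
  then show ?thesis using that card by blast
qed

theorem proposition4:
  fixes p q n :: nat and G :: "('a, 'b) monoid_scheme"
  assumes "prime p" and "prime q" and "p \<noteq> 2" and "q dvd p - 1" and "n \<ge> 2"
    and "nonabelian_P_group p q n G"
  shows "class_C3 G \<longleftrightarrow> n = 2 \<or> (n = 3 \<and> p ^ 2 * q \<ge> 1 + p + 2 * p ^ 2)"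
proof -
  obtain A Q where dec: "P_group_decomposition G A Q p"
    and cardA: "card A = p ^ (n - 1)" and cardQ: "card Q = q"
    using nonabelian_P_group_decomposition[OF assms(1,2,6)] .
  interpret P_group_decomposition G A Q p by (rule dec)
  let ?A = "G\<lparr>carrier := A\<rparr>"
  interpret A: elementary_abelian_group ?A p by (rule elementary_abelian_A)
  have p1: "p > 1" and q1: "q > 1" using assms(1,2) prime_gt_1_nat by auto
  have qp: "q < p" using dvd_imp_le[OF assms(4)] p1 by simp
  have ordA: "order ?A = p ^ (n - 1)" using cardA by (simp add: order_def)
  have ordG: "order G = p ^ (n - 1) * q" using order_eq_card_mult cardA cardQ by simp
  have "finite (carrier G)"
    using ordG p1 q1 by (auto simp: order_def intro!: card_ge_0_finite)
  then have C3: "class_C3 G \<longleftrightarrow> (\<Sum>H | subgroup H ?A. card H) \<le> p ^ (n - 1) * q"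
    unfolding class_C3_def sum_card_normal_subgroups ordG using is_group by (auto simp: mult.commute)
  consider "n = 2" | "n = 3" | "n \<ge> 4" using assms(5) by linarith
  then show ?thesis
  proof cases
    case 1
    have "1 + p \<le> p * 2" using p1 by simp
    also have "\<dots> \<le> p * q" using q1 by (intro mult_le_mono2) simp
    finally show ?thesis
      using 1 C3 A.sum_card_subgroups_rank_1 ordA by simp
  next
    case 2
    then show ?thesis using C3 A.sum_card_subgroups_rank_2 ordA by simp
  next
    case 3
    then have "3 \<le> n - 1" by simp
    from A.sum_card_subgroups_rank_ge_3[OF ordA this qp] show ?thesis
      using 3 C3 by auto
  qed
qed

end
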